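(* Let $m,k\in\mathbb{N}_0$ and $a>0$. Then \[ \int_0^\infty \frac{x^m\ln x\,dx}{(x-1)(x+a)^{k+m+1}} = \frac{\pi^2}{2(a+1)^{k+m+1}} + \frac{(-1)^m}{2\,m!\binom{k+m}{m}a^{k+m+1}}\left.\frac{d^m}{db^m}\left(\frac{\ln^2 b}{(b+1)^{k+1}}\right)\right|_{b=1/a} + \sum_{j=0}^{k-1}\frac{\binom{j+m}{m}}{\binom{k+m}{m}}\,\frac{H_{k-j-1}}{k-j}\,\frac{a^{j-k}}{(a+1)^{j+m+1}} + \frac{(-1)^m}{m!\binom{k+m}{m}a^{k+m+1}}\sum_{j=0}^{k-1}\frac{1}{k-j}\left.\frac{d^m}{db^m}\left(\frac{\ln b}{(b+1)^{j+1}}\right)\right|_{b=1/a}. \]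
   Context: $H_n=\sum_{i=1}^n \frac1i$ denotes the $n$-th harmonic number, with $H_0=0$. The notation $\left.\frac{d^m}{db^m}(\cdot)\right|_{b=1/a}$ means the $m$-th derivative with respect to $b$ (the function itself when $m=0$), evaluated at $b=1/a$. Empty sums (when $k=0$) are zero. *)

theory Defs
  imports "HOL-Analysis.Analysis"
begin

end

theory Submission
  imports Defs "HOL-Real_Asymp.Real_Asymp"
begin

text \<open>
  Write \<open>F m k a\<close> for the integral and \<open>J m k a\<close> for the integral of \<open>x ^ m * ln x / (x + a) ^ (k + m + 2)\<close>.
  Splitting the numerator gives \<open>(1 + a) * F m (k + 1) a = F m k a - J m k a\<close> and
  \<open>(1 + a) * F (m + 1) k a = F m k a + a * J m k a\<close>, so everything is determined by \<open>J\<close>, which is elementary,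
  and by \<open>F 0 0\<close>. The latter satisfies \<open>((1 + a) * F 0 0 a)' = ln a / a\<close>, and its value at \<open>a = 1\<close>
  comes from a geometric series and \<open>\<Sum> 1 / (2 * n + 1)\<^sup>2 = pi\<^sup>2 / 8\<close>.
  With \<open>b = 1 / a\<close>, the right-hand side is \<open>(- 1) ^ m * k! / (k + m)! * b ^ (k + m + 1)\<close> times the \<open>m\<close>-th
  derivative at \<open>b\<close> of one function \<open>S k\<close> satisfying
  \<open>(1 + b) * S k' = (ln b + harm k) / b - (k + 1) * S k\<close>; differentiating this equation \<open>m\<close> times
  yields the same recurrences.
\<close>

subsection \<open>Improper integrals on the positive half-line\<close>

text \<open>Nonnegativity lets the finite one-sided limits of \<open>F\<close> give integrability
  together with the value; the Lebesgue integral is then read as a gauge integral.\<close>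

lemma has_integral_FTC_nonneg:
  fixes f F :: "real \<Rightarrow> real" and a b :: ereal
  assumes "a < b"
    and "\<And>x. x \<in> einterval a b \<Longrightarrow> (F has_real_derivative f x) (at x)"
    and "continuous_on (einterval a b) f"
    and "\<And>x. x \<in> einterval a b \<Longrightarrow> 0 \<le> f x"
    and "((F \<circ> real_of_ereal) \<longlongrightarrow> A) (at_right a)"
    and "((F \<circ> real_of_ereal) \<longlongrightarrow> B) (at_left b)"
  shows "(f has_integral (B - A)) (einterval a b)"
proof -
  have cont: "isCont f x" if "x \<in> einterval a b" for x
    using assms(3) that by (simp add: continuous_on_eq_continuous_at)
  have int: "set_integrable lborel (einterval a b) f" "(LBINT x=a..b. f x) = B - A"
    using assms cont
    by (intro interval_integral_FTC_nonneg[where F = F]; simp add: einterval_def)+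
  show ?thesis
    using set_borel_integral_eq_integral[OF int(1)] int(2) assms(1)
    by (simp add: interval_lebesgue_integral_le_eq has_integral_iff)
qed

text \<open>The half-line is cut at 1, where \<open>ln\<close> changes sign, so that the integrands
  have constant sign on each piece. At the cut the antiderivative is continuous, so its value there
  serves as the limit.\<close>

lemma has_integral_FTC_nonneg_01:
  fixes f F :: "real \<Rightarrow> real"
  assumes "\<And>x. 0 < x \<Longrightarrow> x < 1 \<Longrightarrow> (F has_real_derivative f x) (at x)"
    and "continuous_on {0<..<1} f"
    and "\<And>x. 0 < x \<Longrightarrow> x < 1 \<Longrightarrow> 0 \<le> f x"
    and "(F \<longlongrightarrow> A) (at_right 0)" and "isCont F 1"
  shows "(f has_integral (F 1 - A)) {0<..<1}"
proof -
  have "(f has_integral (F 1 - A)) (einterval (ereal 0) (ereal 1))"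
  proof (rule has_integral_FTC_nonneg)
    show "((F \<circ> real_of_ereal) \<longlongrightarrow> F 1) (at_left (ereal 1))"
      using assms(5) unfolding ereal_tendsto_simps isCont_def by (rule tendsto_within_subset) auto
    show "((F \<circ> real_of_ereal) \<longlongrightarrow> A) (at_right (ereal 0))"
      using assms(4) unfolding ereal_tendsto_simps .
  qed (use assms in auto)
  then show ?thesis by simp
qed

lemma has_integral_FTC_nonneg_1_inf:
  fixes f F :: "real \<Rightarrow> real"
  assumes "\<And>x. 1 < x \<Longrightarrow> (F has_real_derivative f x) (at x)"
    and "continuous_on {1<..} f"
    and "\<And>x. 1 < x \<Longrightarrow> 0 \<le> f x"
    and "isCont F 1" and "(F \<longlongrightarrow> B) at_top"
  shows "(f has_integral (B - F 1)) {1<..}"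
proof -
  have "(f has_integral (B - F 1)) (einterval (ereal 1) \<infinity>)"
  proof (rule has_integral_FTC_nonneg)
    show "((F \<circ> real_of_ereal) \<longlongrightarrow> F 1) (at_right (ereal 1))"
      using assms(4) unfolding ereal_tendsto_simps isCont_def by (rule tendsto_within_subset) auto
    show "((F \<circ> real_of_ereal) \<longlongrightarrow> B) (at_left \<infinity>)"
      using assms(5) unfolding ereal_tendsto_simps .
  qed (use assms in auto)
  then show ?thesis by simp
qed

lemma has_integral_Un_at_1:
  fixes f :: "real \<Rightarrow> real"
  assumes "(f has_integral i) {0<..<1}" "(f has_integral j) {1<..}"
  shows "(f has_integral (i + j)) {0<..}"
proof -
  have "{0<..<1} \<inter> {1<..} = ({} :: real set)" by auto
  then have "(f has_integral (i + j)) ({0<..<1} \<union> {1<..})"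
    using assms by (intro has_integral_Un) auto
  moreover have "sym_diff ({0<..<1} \<union> {1<..}) {0<..} \<subseteq> {1::real}" by auto
  ultimately show ?thesis
    by (subst (asm) has_integral_spike_set_eq[of _ "{0<..}"]) (auto intro: negligible_subset[of "{1}"])
qed

subsection \<open>The case $a = 1$, $m = k = 0$\<close>

text \<open>Integration by parts. These are the termwise integrals of the geometric expansion used
  below on the unit interval.\<close>

lemma neg_ln_power_integral_01:
  "((\<lambda>x::real. - ln x * x ^ q) has_integral 1 / (real q + 1)\<^sup>2) {0<..<1}"
proof -
  define c where "c = real q + 1"
  have c: "c > 0" by (simp add: c_def)
  define F where "F = (\<lambda>x::real. - (x ^ Suc q * ln x) / c + x ^ Suc q / c\<^sup>2)"
  have "((\<lambda>x::real. - ln x * x ^ q) has_integral F 1 - 0) {0<..<1}"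
  proof (rule has_integral_FTC_nonneg_01)
    show "(F has_real_derivative - ln x * x ^ q) (at x)" if "0 < x" "x < 1" for x
    proof -
      have "((\<lambda>x. x ^ Suc q) has_real_derivative c * x ^ q) (at x)"
        by (rule derivative_eq_intros refl)+ (simp add: c_def)
      from DERIV_add[OF DERIV_cdivide[OF DERIV_minus[OF DERIV_mult[OF this DERIV_ln_divide[OF that(1)]]], of c]
            DERIV_cdivide[OF this, of "c\<^sup>2"]]
      show ?thesis
        unfolding F_def by (rule DERIV_cong) (use that c in \<open>simp add: field_simps power2_eq_square\<close>)
    qed
    show "isCont F 1" unfolding F_def using c by (intro continuous_intros) auto
    show "(F \<longlongrightarrow> 0) (at_right 0)" unfolding F_def using c by real_asymp
  qed (auto intro!: continuous_intros simp: mult_nonpos_nonneg)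
  then show ?thesis by (simp add: F_def c_def)
qed

text \<open>Mirror image of \<open>neg_ln_power_integral_01\<close> under the substitution of
  \<open>1 / x\<close> for \<open>x\<close>, which explains the shift by 2 in the exponent and the
  equal value.\<close>

lemma ln_power_integral_1_inf:
  "((\<lambda>x::real. ln x * inverse x ^ (q + 2)) has_integral 1 / (real q + 1)\<^sup>2) {1<..}"
proof -
  define c where "c = real q + 1"
  have c: "c > 0" by (simp add: c_def)
  define F where "F = (\<lambda>x::real. - (inverse x ^ Suc q * (ln x / c + 1 / c\<^sup>2)))"
  have "((\<lambda>x::real. ln x * inverse x ^ (q + 2)) has_integral 0 - F 1) {1<..}"
  proof (rule has_integral_FTC_nonneg_1_inf)
    show "(F has_real_derivative ln x * inverse x ^ (q + 2)) (at x)" if "1 < x" for x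
    proof -
      have "((\<lambda>x. inverse x ^ Suc q) has_real_derivative - c * inverse x ^ (q + 2)) (at x)"
        by (rule DERIV_cong[OF DERIV_power_Suc[OF DERIV_inverse]])
           (use that in \<open>simp_all add: c_def algebra_simps\<close>)
      moreover have "((\<lambda>x. ln x / c + 1 / c\<^sup>2) has_real_derivative inverse x / c) (at x)"
        using that c by (auto intro!: derivative_eq_intros simp: field_simps)
      ultimately have "(F has_real_derivative - (- c * inverse x ^ (q + 2) * (ln x / c + 1 / c\<^sup>2)
          + inverse x / c * inverse x ^ Suc q)) (at x)"
        unfolding F_def by (intro DERIV_minus DERIV_mult)
      then show ?thesis
      proof (rule DERIV_cong)
        have 1: "inverse x / c * inverse x ^ Suc q = inverse x ^ (q + 2) / c" by simp
        have 2: "- (- c * w * (ln x / c + 1 / c\<^sup>2) + w / c) = ln x * w" for w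
          using c by (simp add: field_simps power2_eq_square)
        show "- (- c * inverse x ^ (q + 2) * (ln x / c + 1 / c\<^sup>2)
          + inverse x / c * inverse x ^ Suc q) = ln x * inverse x ^ (q + 2)"
          unfolding 1 by (rule 2)
      qed
    qed
    show "isCont F 1" unfolding F_def using c by (intro continuous_intros) auto
    show "(F \<longlongrightarrow> 0) at_top" unfolding F_def using c by real_asymp
  qed (auto intro!: continuous_intros)
  then show ?thesis by (simp add: F_def c_def)
qed

text \<open>Grouping the series for \<open>pi\<^sup>2 / 6\<close> in pairs puts one odd and one even
  square in each block; the even ones form a quarter of the whole series and are subtracted.\<close>

lemma odd_inverse_squares_sums: "(\<lambda>n. 1 / (2 * real n + 1)\<^sup>2) sums (pi\<^sup>2 / 8)"
proof -
  have "(\<lambda>n. \<Sum>i = n * 2..<n * 2 + 2. 1 / (real i + 1)\<^sup>2) sums (pi\<^sup>2 / 6)"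
    using sums_group[OF inverse_squares_sums, of 2] by (simp add: add_ac)
  moreover have "(\<lambda>n. 1 / 4 * (1 / (real n + 1)\<^sup>2)) sums (1 / 4 * (pi\<^sup>2 / 6))"
    using inverse_squares_sums by (intro sums_mult) (simp add: add_ac)
  ultimately have "(\<lambda>n. (\<Sum>i = n * 2..<n * 2 + 2. 1 / (real i + 1)\<^sup>2) - 1 / 4 * (1 / (real n + 1)\<^sup>2))
      sums (pi\<^sup>2 / 6 - 1 / 4 * (pi\<^sup>2 / 6))"
    by (rule sums_diff)
  moreover have "(\<Sum>i = n * 2..<n * 2 + 2. 1 / (real i + 1)\<^sup>2) - 1 / 4 * (1 / (real n + 1)\<^sup>2)
      = 1 / (2 * real n + 1)\<^sup>2" for n
  proof -
    have "(real n * 2 + 2)\<^sup>2 = 4 * (real n + 1)\<^sup>2" by (simp add: power2_eq_square algebra_simps)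
    then show ?thesis by (simp add: numeral_2_eq_2 add_ac mult_ac)
  qed
  ultimately show ?thesis by simp
qed

text \<open>Expanding \<open>1 / (1 - x\<^sup>2)\<close> geometrically gives nonnegative terms, so
  monotone convergence allows termwise integration.\<close>

lemma ln_over_square_minus_one_integral_01:
  "((\<lambda>x::real. ln x / ((x - 1) * (x + 1))) has_integral pi\<^sup>2 / 8) {0<..<1}"
proof (rule has_integral_monotone_convergence_increasing)
  show "((\<lambda>x. \<Sum>n<N. - ln x * x ^ (2 * n)) has_integral (\<Sum>n<N. 1 / (2 * real n + 1)\<^sup>2)) {0<..<1}" for N
    using neg_ln_power_integral_01[of "2 * n" for n] by (intro has_integral_sum) auto
  show "(\<lambda>N. \<Sum>n<N. - ln x * x ^ (2 * n)) \<longlonglongrightarrow> ln x / ((x - 1) * (x + 1))" if "x \<in> {0<..<1}" for x :: real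
  proof -
    have "x\<^sup>2 < 1" using that by (simp add: abs_square_less_1)
    then have "(\<lambda>n. - ln x * (x\<^sup>2) ^ n) sums (- ln x * (1 / (1 - x\<^sup>2)))"
      by (intro sums_mult geometric_sums) auto
    moreover have "- ln x * (1 / (1 - x\<^sup>2)) = ln x / ((x - 1) * (x + 1))"
      using \<open>x\<^sup>2 < 1\<close> that by (simp add: divide_simps power2_eq_square) (simp add: algebra_simps)
    ultimately show ?thesis by (simp add: sums_def power_mult)
  qed
qed (use odd_inverse_squares_sums in \<open>auto simp: sums_def mult_nonpos_nonneg\<close>)

lemma ln_over_square_minus_one_integral_1_inf:
  "((\<lambda>x::real. ln x / ((x - 1) * (x + 1))) has_integral pi\<^sup>2 / 8) {1<..}"
proof (rule has_integral_monotone_convergence_increasing)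
  show "((\<lambda>x. \<Sum>n<N. ln x * inverse x ^ (2 * n + 2)) has_integral (\<Sum>n<N. 1 / (2 * real n + 1)\<^sup>2)) {1<..}" for N
    using ln_power_integral_1_inf[of "2 * n" for n] by (intro has_integral_sum) auto
  show "(\<lambda>N. \<Sum>n<N. ln x * inverse x ^ (2 * n + 2)) \<longlonglongrightarrow> ln x / ((x - 1) * (x + 1))" if "x \<in> {1<..}" for x :: real
  proof -
    have x: "x\<^sup>2 > 1" using that by simp
    then have "(inverse x)\<^sup>2 < 1" by (simp add: power_inverse inverse_less_1_iff)
    \<comment> \<open>Beyond 1 the expansion runs in powers of \<open>1 / x\<^sup>2\<close>; the
      extra factor comes from pulling \<open>x\<^sup>2\<close> out of
      \<open>x\<^sup>2 - 1\<close>.\<close>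
    then have "(\<lambda>n. ln x * (inverse x)\<^sup>2 * ((inverse x)\<^sup>2) ^ n) sums (ln x * (inverse x)\<^sup>2 * (1 / (1 - (inverse x)\<^sup>2)))"
      by (intro sums_mult geometric_sums) simp
    moreover have "ln x * (inverse x)\<^sup>2 * (1 / (1 - (inverse x)\<^sup>2)) = ln x / ((x - 1) * (x + 1))"
      using x that by (simp add: divide_simps power2_eq_square) (simp add: algebra_simps)
    moreover have "ln x * (inverse x)\<^sup>2 * ((inverse x)\<^sup>2) ^ n = ln x * inverse x ^ (2 * n + 2)" for n
      by (simp only: power_add power_mult) (simp only: mult_ac)
    ultimately show ?thesis
      by (simp only: sums_def)
  qed
qed (use odd_inverse_squares_sums in \<open>auto simp: sums_def\<close>)


lemma ln_over_square_minus_one_integral: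
  "((\<lambda>x::real. ln x / ((x - 1) * (x + 1))) has_integral pi\<^sup>2 / 4) {0<..}"
  using has_integral_Un_at_1[OF ln_over_square_minus_one_integral_01
      ln_over_square_minus_one_integral_1_inf] by simp

subsection \<open>The integrals without a pole at 1\<close>

lemma ln_rational_integral_base:
  fixes a :: real
  assumes a: "a > 0"
  shows "((\<lambda>x. x ^ m * ln x / (x + a) ^ (m + 2)) has_integral
           (ln a + harm m) / (real (m + 1) * a)) {0<..}"
proof -
  \<comment> \<open>Integration by parts, using that \<open>t = y / (y + a)\<close> has derivative \<open>a / (y + a)\<^sup>2\<close>.\<close>
  define A where "A = (\<lambda>y. (ln y * (y / (y + a)) ^ (m + 1) - ln (y + a)
      + (\<Sum>i<m. (y / (y + a)) ^ Suc i / real (Suc i))) / (real (m + 1) * a))"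
  let ?f = "\<lambda>x. x ^ m * ln x / (x + a) ^ (m + 2)"
  have deriv: "(A has_real_derivative ?f y) (at y)" if y: "y > 0" for y
  proof -
    define t where "t = y / (y + a)"
    have dt: "((\<lambda>y. y / (y + a)) has_real_derivative a / (y + a)\<^sup>2) (at y)"
      using y a by (auto intro!: derivative_eq_intros simp: power2_eq_square)
    have pow: "((\<lambda>y. (y / (y + a)) ^ Suc i) has_real_derivative real (Suc i) * (a / (y + a)\<^sup>2 * t ^ i)) (at y)" for i
      using DERIV_power_Suc[OF dt, of i] by (simp add: t_def)
    have dsum: "((\<lambda>y. \<Sum>i<m. (y / (y + a)) ^ Suc i / real (Suc i)) has_real_derivative
        (\<Sum>i<m. a / (y + a)\<^sup>2 * t ^ i)) (at y)"
      by (intro DERIV_sum DERIV_cong[OF DERIV_cdivide[OF pow]]) (simp del: of_nat_Suc)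
    \<comment> \<open>The finite geometric sum reduces the derivative of the last two summands of
      \<open>A\<close> to \<open>- t ^ m / (y + a)\<close>, which cancels the term left over by the
      product rule.\<close>
    have "(1 - t) * (\<Sum>i<m. t ^ i) = 1 - t ^ m"
      by (simp add: one_diff_power_eq)
    moreover have "1 - t = a / (y + a)" using y a by (simp add: t_def field_simps)
    ultimately have "a / (y + a) * (\<Sum>i<m. t ^ i) / (y + a) = (1 - t ^ m) / (y + a)"
      by simp
    then have geo: "(\<Sum>i<m. a / (y + a)\<^sup>2 * t ^ i) = (1 - t ^ m) / (y + a)"
      by (simp only: sum_distrib_left[symmetric]) (simp add: power2_eq_square)
    have dprod: "((\<lambda>y. ln y * (y / (y + a)) ^ (m + 1)) has_real_derivative
        1 / y * t ^ (m + 1) + real (m + 1) * (a / (y + a)\<^sup>2 * t ^ m) * ln y) (at y)"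
      using DERIV_mult[OF DERIV_ln_divide[OF y] pow[of m]] by (simp only: t_def Suc_eq_plus1)
    have dln: "((\<lambda>y. ln (y + a)) has_real_derivative 1 / (y + a)) (at y)"
      using y a by (auto intro!: derivative_eq_intros)
    have "(A has_real_derivative ((1 / y * t ^ (m + 1) + real (m + 1) * (a / (y + a)\<^sup>2 * t ^ m) * ln y)
        - 1 / (y + a) + (1 - t ^ m) / (y + a)) / (real (m + 1) * a)) (at y)"
      unfolding A_def geo[symmetric]
      by (intro DERIV_cdivide DERIV_add DERIV_diff dsum dprod dln)
    then show ?thesis
    proof (rule DERIV_cong)
      have "1 / y * t ^ (m + 1) = t ^ m / (y + a)" using y a by (simp add: t_def)
      then have "((1 / y * t ^ (m + 1) + real (m + 1) * (a / (y + a)\<^sup>2 * t ^ m) * ln y)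
        - 1 / (y + a) + (1 - t ^ m) / (y + a)) = real (m + 1) * a * (t ^ m / (y + a)\<^sup>2 * ln y)"
        by (simp add: diff_divide_distrib)
      then show "((1 / y * t ^ (m + 1) + real (m + 1) * (a / (y + a)\<^sup>2 * t ^ m) * ln y)
        - 1 / (y + a) + (1 - t ^ m) / (y + a)) / (real (m + 1) * a) = ?f y"
        using y a by (simp add: t_def power_divide power_add power2_eq_square del: of_nat_Suc of_nat_add)
    qed
  qed
  have lim0: "(A \<longlongrightarrow> (- ln a + (\<Sum>i<m. 0 / real (Suc i))) / (real (m + 1) * a)) (at_right 0)"
    unfolding A_def
    by (intro tendsto_divide tendsto_add tendsto_sum tendsto_const)
       (use a in \<open>(simp; fail) | real_asymp\<close>)+
  \<comment> \<open>At infinity \<open>y / (y + a)\<close> tends to 1 and the two logarithmic terms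
    cancel, so only the harmonic sum survives; at 0 only \<open>- ln a\<close> does.\<close>
  have lim1: "(A \<longlongrightarrow> (0 + (\<Sum>i<m. 1 / real (Suc i))) / (real (m + 1) * a)) at_top"
    unfolding A_def
    by (intro tendsto_divide tendsto_add tendsto_sum tendsto_const)
       (use a in \<open>(simp; fail) | real_asymp\<close>)+
  have cont: "isCont A 1"
    using deriv[of 1] by (auto intro: DERIV_isCont)
  have contf: "continuous_on S ?f" if "S \<subseteq> {0<..}" for S
    using that a by (auto intro!: continuous_intros)
  \<comment> \<open>On the unit interval the logarithm is negative, hence the change of
    sign.\<close>
  have "((\<lambda>x. - ?f x) has_integral (- A 1 - - ((- ln a + (\<Sum>i<m. 0 / real (Suc i))) / (real (m + 1) * a)))) {0<..<1}"
    using a by (intro has_integral_FTC_nonneg_01 DERIV_minus deriv tendsto_minus lim0 continuous_minus cont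
        continuous_on_minus contf) (auto simp: mult_nonneg_nonpos divide_nonpos_pos)
  from has_integral_neg[OF this]
  have "(?f has_integral (A 1 + ln a / (real (m + 1) * a))) {0<..<1}"
    by (simp add: add.commute)
  moreover have "(?f has_integral (0 + (\<Sum>i<m. 1 / real (Suc i))) / (real (m + 1) * a) - A 1) {1<..}"
    using a by (intro has_integral_FTC_nonneg_1_inf deriv lim1 cont contf) auto
  moreover have "(\<Sum>i<m. 1 / real (Suc i)) = harm m"
    by (simp add: harm_def sum.atLeast1_atMost_eq field_simps)
  ultimately show ?thesis
    using has_integral_Un_at_1[of ?f] by (fastforce simp: add_divide_distrib)
qed

text \<open>Since \<open>a * x ^ m = x ^ m * (x + a) - x ^ (m + 1)\<close>, the integral for
  \<open>k + 1\<close> is a difference of integrals for \<open>k\<close>, one of them with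
  \<open>m + 1\<close>; therefore \<open>m\<close> is arbitrary in the induction.\<close>

lemma ln_rational_integral:
  fixes a :: real
  assumes a: "a > 0"
  shows "((\<lambda>x. x ^ m * ln x / (x + a) ^ (k + m + 2)) has_integral
           fact m * fact k / fact (k + m + 1) * (ln a + harm m - harm k) / a ^ (k + 1)) {0<..}"
proof (induction k arbitrary: m)
  case 0
  have eq: "fact m * fact 0 / fact (0 + m + 1) = 1 / real (m + 1)" by simp
  show ?case
    unfolding eq using ln_rational_integral_base[OF a, of m] by (simp add: harm_def)
next
  case (Suc k)
  let ?f = "\<lambda>m k x. x ^ m * ln x / (x + a) ^ (k + m + 2)"
  let ?L = "ln a + harm m - harm k"
  let ?J = "\<lambda>m k. fact m * fact k / fact (k + m + 1) * (ln a + harm m - harm k) / a ^ (k + 1)"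
  have "((\<lambda>x. (?f m k x - ?f (Suc m) k x) / a) has_integral ((?J m k - ?J (Suc m) k) / a)) {0<..}"
    by (intro has_integral_divide has_integral_diff Suc.IH)
  moreover have "(?f m k x - ?f (Suc m) k x) / a = ?f m (Suc k) x" if "x \<in> {0<..}" for x
    using that a by (simp add: divide_simps) (simp add: algebra_simps)
  moreover have "(?J m k - ?J (Suc m) k) / a = ?J m (Suc k)"
  proof -
    \<comment> \<open>With this common factor removed, the claim is the linear identity
      \<open>(k + m + 2) * L - ((m + 1) * L + 1) = (k + 1) * L - 1\<close>, where \<open>L\<close>
      stands for \<open>?L\<close>.\<close>
    define q where "q = fact m * fact k / fact (Suc k + m + 1) / a ^ (k + 1)"
    have 1: "?J m k = q * (real (k + m + 2) * ?L)"
      by (simp add: q_def divide_simps)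
    have 2: "?J (Suc m) k = q * (real (m + 1) * ?L + 1)"
      by (simp add: q_def divide_simps harm_Suc) (simp add: algebra_simps)
    have 3: "?J m (Suc k) = q * (real (k + 1) * ?L - 1) / a"
      using a by (simp add: q_def divide_simps harm_Suc) (simp add: algebra_simps)
    show ?thesis
      unfolding 1 2 3 by (simp add: algebra_simps)
  qed
  ultimately show ?case
    by (simp only: has_integral_cong[of "{0<..}" "\<lambda>x. (?f m k x - ?f (Suc m) k x) / a" "?f m (Suc k)"])
qed


subsection \<open>The case $m = k = 0$\<close>

text \<open>Numerator and denominator have the same sign; at \<open>x = 1\<close> division by zero
  yields 0.\<close>

lemma ln_over_minus_one_nonneg: "0 < x \<Longrightarrow> 0 \<le> ln x / (x - 1)" for x :: real
  by (cases "x < 1") (auto intro: divide_nonpos_neg)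

lemma ln_over_pole_nonneg: "0 < x \<Longrightarrow> 0 \<le> c \<Longrightarrow> 0 \<le> ln x / ((x - 1) * c)" for x c :: real
  using ln_over_minus_one_nonneg[of x] divide_nonneg_nonneg[of "ln x / (x - 1)" c] by simp

text \<open>Comparison with the case \<open>a = 1\<close>: the integrands differ by the bounded
  factor \<open>(x + 1) / (x + a)\<close>, and absolute integrability survives such factors.\<close>

lemma ln_rational_integrable:
  fixes a :: real
  assumes a: "a > 0"
  shows "(\<lambda>x. ln x / ((x - 1) * (x + a))) integrable_on {0<..}"
proof -
  have "(\<lambda>x::real. ln x / ((x - 1) * (x + 1))) absolutely_integrable_on {0<..}"
    using ln_over_square_minus_one_integral
    by (intro nonnegative_absolutely_integrable_1)
       (auto intro!: ln_over_pole_nonneg)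
  moreover have "bounded ((\<lambda>x. (x + 1) / (x + a)) ` {0<..})"
  proof -
    have "\<bar>(x + 1) / (x + a)\<bar> \<le> 1 + 1 / a" if "x > 0" for x
    proof -
      have "(x + 1) / (x + a) = x / (x + a) + 1 / (x + a)" by (simp add: add_divide_distrib)
      also have "\<dots> \<le> 1 + 1 / a" using that a by (intro add_mono) (auto simp: frac_le)
      finally show ?thesis using that a by simp
    qed
    then show ?thesis by (auto simp: bounded_iff)
  qed
  moreover have "(\<lambda>x. (x + 1) / (x + a)) \<in> borel_measurable (lebesgue_on {0<..})"
    using a by (intro continuous_imp_measurable_on_sets_lebesgue continuous_intros) auto
  ultimately have "(\<lambda>x. (x + 1) / (x + a) * (ln x / ((x - 1) * (x + 1)))) absolutely_integrable_on {0<..}"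
    by (intro absolutely_integrable_bounded_measurable_product_real) auto
  then have "(\<lambda>x. (x + 1) / (x + a) * (ln x / ((x - 1) * (x + 1)))) integrable_on {0<..}"
    by (rule set_lebesgue_integral_eq_integral)
  then show ?thesis
    by (rule integrable_eq) auto
qed

text \<open>Serves to differentiate under the integral sign: the first-order remainder is itself an
  integral that can be bounded quadratically.\<close>

lemma has_real_derivative_quadratic_remainder:
  fixes f :: "real \<Rightarrow> real"
  assumes "d > 0" and "\<And>y. \<bar>y - x\<bar> < d \<Longrightarrow> \<bar>f y - f x - D * (y - x)\<bar> \<le> K * (y - x)\<^sup>2"
  shows "(f has_real_derivative D) (at x)"
proof -
  have "((\<lambda>y. (f y - f x) / (y - x) - D) \<longlongrightarrow> 0) (at x)"
  proof (rule Lim_null_comparison)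
    have "\<bar>(f y - f x) / (y - x) - D\<bar> \<le> K * \<bar>y - x\<bar>" if "y \<noteq> x" "\<bar>y - x\<bar> < d" for y
    proof -
      have "\<bar>(f y - f x) / (y - x) - D\<bar> = \<bar>f y - f x - D * (y - x)\<bar> / \<bar>y - x\<bar>"
        using that by (simp add: abs_divide[symmetric] diff_divide_distrib)
      also have "\<dots> \<le> K * (y - x)\<^sup>2 / \<bar>y - x\<bar>" using assms(2)[OF that(2)] by (simp add: divide_right_mono)
      also have "\<dots> = K * \<bar>y - x\<bar>"
        using that by (simp add: power2_eq_square field_simps abs_if)
      finally show ?thesis .
    qed
    then show "\<forall>\<^sub>F y in at x. norm ((f y - f x) / (y - x) - D) \<le> K * \<bar>y - x\<bar>"
      using assms(1) by (auto simp: eventually_at dist_real_def)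
    show "((\<lambda>y. K * \<bar>y - x\<bar>) \<longlongrightarrow> 0) (at x)"
      by (auto intro!: tendsto_eq_intros)
  qed
  then show ?thesis
    by (simp add: has_field_derivative_iff LIM_zero_iff)
qed

text \<open>The two reductions rest on \<open>1 + a = (x + a) - (x - 1)\<close> and
  \<open>(1 + a) * x = (x + a) + a * (x - 1)\<close>. The point 1 is removed because
  \<open>x - 1\<close> is cancelled.\<close>

lemma pole_reduction_integral:
  fixes a :: real
  assumes a: "a > 0"
    and "((\<lambda>x. x ^ m * ln x / ((x - 1) * (x + a) ^ (k + m + 1))) has_integral F) {0<..}"
  shows "((\<lambda>x. x ^ m * ln x / ((x - 1) * (x + a) ^ (Suc k + m + 1))) has_integral
      (F - fact m * fact k / fact (k + m + 1) * (ln a + harm m - harm k) / a ^ (k + 1)) / (1 + a)) {0<..}"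
    and "((\<lambda>x. x ^ Suc m * ln x / ((x - 1) * (x + a) ^ (k + Suc m + 1))) has_integral
      (F + a * (fact m * fact k / fact (k + m + 1) * (ln a + harm m - harm k) / a ^ (k + 1))) / (1 + a)) {0<..}"
proof -
  note F = assms(2) and J = ln_rational_integral[OF a, of m k]
  show "((\<lambda>x. x ^ m * ln x / ((x - 1) * (x + a) ^ (Suc k + m + 1))) has_integral
      (F - fact m * fact k / fact (k + m + 1) * (ln a + harm m - harm k) / a ^ (k + 1)) / (1 + a)) {0<..}"
  proof (rule has_integral_spike_finite[OF _ _ has_integral_divide[OF has_integral_diff[OF F J]], of "{1}"])
    fix x :: real assume x: "x \<in> {0<..} - {1}"
    show "x ^ m * ln x / ((x - 1) * (x + a) ^ (Suc k + m + 1)) =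
        (x ^ m * ln x / ((x - 1) * (x + a) ^ (k + m + 1)) - x ^ m * ln x / (x + a) ^ (k + m + 2)) / (1 + a)"
    proof -
      define P where "P = (x + a) ^ (k + m + 1)"
      have "P > 0" using x a by (simp add: P_def)
      have "(x + a) ^ (Suc k + m + 1) = (x + a) * P" "(x + a) ^ (k + m + 2) = (x + a) * P"
        by (simp_all add: P_def)
      then show ?thesis
        unfolding P_def[symmetric] using x a \<open>P > 0\<close> by (simp add: divide_simps) (simp add: algebra_simps)
    qed
  qed simp
  show "((\<lambda>x. x ^ Suc m * ln x / ((x - 1) * (x + a) ^ (k + Suc m + 1))) has_integral
      (F + a * (fact m * fact k / fact (k + m + 1) * (ln a + harm m - harm k) / a ^ (k + 1))) / (1 + a)) {0<..}"
  proof (rule has_integral_spike_finite[OF _ _ has_integral_divide[OF has_integral_add[OF F has_integral_mult_right[OF J, of a]]], of "{1}"])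
    fix x :: real assume x: "x \<in> {0<..} - {1}"
    show "x ^ Suc m * ln x / ((x - 1) * (x + a) ^ (k + Suc m + 1)) =
        (x ^ m * ln x / ((x - 1) * (x + a) ^ (k + m + 1)) + a * (x ^ m * ln x / (x + a) ^ (k + m + 2))) / (1 + a)"
    proof -
      define P where "P = (x + a) ^ (k + m + 1)"
      have "P > 0" using x a by (simp add: P_def)
      have "(x + a) ^ (k + Suc m + 1) = (x + a) * P" "(x + a) ^ (k + m + 2) = (x + a) * P"
        by (simp_all add: P_def)
      then show ?thesis
        unfolding P_def[symmetric] using x a \<open>P > 0\<close> by (simp add: divide_simps) (simp add: algebra_simps)
    qed
  qed simp
qed

lemma ln_pole_integral_base:
  fixes a :: real
  assumes a: "a > 0"
  shows "((\<lambda>x. ln x / ((x - 1) * (x + a))) has_integral (pi\<^sup>2 + (ln a)\<^sup>2) / (2 * (1 + a))) {0<..}"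
proof -
  define F where "F = (\<lambda>a::real. integral {0<..} (\<lambda>x. ln x / ((x - 1) * (x + a))))"
  have F: "((\<lambda>x. ln x / ((x - 1) * (x + a))) has_integral F a) {0<..}" if "a > 0" for a
    using ln_rational_integrable[OF that] by (simp add: F_def integrable_integral)
  \<comment> \<open>This integral is minus the formal derivative of \<open>F\<close> in the
    parameter. The reduction expresses it through \<open>F a\<close>, which gives a differential
    equation.\<close>
  have F': "((\<lambda>x. ln x / ((x - 1) * (x + a)\<^sup>2)) has_integral (F a - ln a / a) / (1 + a)) {0<..}"
    if "a > 0" for a
    using pole_reduction_integral(1)[OF that, of 0 0] F[OF that] by (simp add: power2_eq_square harm_def)
  have dF: "(F has_real_derivative - ((F a - ln a / a) / (1 + a))) (at a)" if a: "a > 0" for a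
  proof (rule has_real_derivative_quadratic_remainder)
    \<comment> \<open>This radius keeps \<open>c > a / 2\<close>, so \<open>1 / (x + c)\<close> is
      at most \<open>2 / a\<close> for all positive \<open>x\<close>.\<close>
    show "a / 2 > 0" using a by simp
    fix c assume "\<bar>c - a\<bar> < a / 2"
    then have c: "c > a / 2" by linarith
    then have c0: "c > 0" using a by simp
    let ?g = "\<lambda>x. ln x / ((x - 1) * (x + c)) - ln x / ((x - 1) * (x + a)) + (c - a) * (ln x / ((x - 1) * (x + a)\<^sup>2))"
    let ?v = "F c - F a + (c - a) * ((F a - ln a / a) / (1 + a))"
    have g: "(?g has_integral ?v) {0<..}"
      by (intro has_integral_add has_integral_diff has_integral_mult_right F F' a c0)
    \<comment> \<open>The first-order remainder of \<open>1 / (x + c)\<close> around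
      \<open>a\<close> is an explicit nonnegative square term, so its integral lies between 0 and a
      multiple of \<open>(c - a)\<^sup>2\<close>.\<close>
    have gx: "?g x = (c - a)\<^sup>2 / (x + c) * (ln x / ((x - 1) * (x + a)\<^sup>2))" if "x > 0" for x
    proof (cases "x = 1")
      case False
      then show ?thesis using that a c0 by (simp add: divide_simps) (simp add: algebra_simps power2_eq_square)
    qed simp
    have "0 \<le> ?v"
    proof (rule has_integral_nonneg[OF g])
      fix x :: real assume "x \<in> {0<..}"
      then have x: "x > 0" by simp
      show "0 \<le> ?g x"
        unfolding gx[OF x] using x c0 by (intro mult_nonneg_nonneg ln_over_pole_nonneg) auto
    qed
    moreover have "?v \<le> (c - a)\<^sup>2 * (2 / a) * ((F a - ln a / a) / (1 + a))"
    proof (rule has_integral_le[OF g has_integral_mult_right[OF F'[OF a]]])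
      fix x :: real assume "x \<in> {0<..}"
      then have x: "x > 0" by simp
      have "(c - a)\<^sup>2 / (x + c) \<le> (c - a)\<^sup>2 / (a / 2)"
        using x a c by (intro divide_left_mono) auto
      then have "(c - a)\<^sup>2 / (x + c) * (ln x / ((x - 1) * (x + a)\<^sup>2))
          \<le> (c - a)\<^sup>2 / (a / 2) * (ln x / ((x - 1) * (x + a)\<^sup>2))"
        using x by (intro mult_right_mono ln_over_pole_nonneg) auto
      then show "?g x \<le> (c - a)\<^sup>2 * (2 / a) * (ln x / ((x - 1) * (x + a)\<^sup>2))"
        unfolding gx[OF x] by (simp add: mult_ac)
    qed
    ultimately have bound: "\<bar>?v\<bar> \<le> 2 / a * ((F a - ln a / a) / (1 + a)) * (c - a)\<^sup>2"
      by (subst abs_of_nonneg) (simp_all only: mult.commute[of _ "(c - a)\<^sup>2"] mult.assoc)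
    have eq: "F c - F a - - ((F a - ln a / a) / (1 + a)) * (c - a) = ?v" by simp
    show "\<bar>F c - F a - - ((F a - ln a / a) / (1 + a)) * (c - a)\<bar>
        \<le> 2 / a * ((F a - ln a / a) / (1 + a)) * (c - a)\<^sup>2"
      unfolding eq by (rule bound)
  qed
  \<comment> \<open>The equation for \<open>F\<close> says that \<open>(1 + a) * F a\<close> has
    derivative \<open>ln a / a\<close>, the derivative of \<open>(ln a)\<^sup>2 / 2\<close>.\<close>
  have "\<exists>C. \<forall>a\<in>{0<..}. (1 + a) * F a - (ln a)\<^sup>2 / 2 = C"
  proof (rule has_field_derivative_zero_constant)
    fix a :: real assume "a \<in> {0<..}"
    then have a: "a > 0" by simp
    have "((\<lambda>a. (1 + a) * F a - (ln a)\<^sup>2 / 2) has_real_derivative 0) (at a)"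
      by (rule derivative_eq_intros dF refl a | simp)+
         (use a in \<open>simp add: divide_simps\<close>)
    then show "((\<lambda>a. (1 + a) * F a - (ln a)\<^sup>2 / 2) has_real_derivative 0) (at a within {0<..})"
      by (rule has_field_derivative_at_within)
  qed simp
  then obtain C where C: "\<And>a. a > 0 \<Longrightarrow> (1 + a) * F a - (ln a)\<^sup>2 / 2 = C" by auto
  have "F 1 = pi\<^sup>2 / 4"
    using has_integral_unique[OF F[of 1] ln_over_square_minus_one_integral] by simp
  then have "C = pi\<^sup>2 / 2" using C[of 1] by simp
  then have "F a = (pi\<^sup>2 + (ln a)\<^sup>2) / (2 * (1 + a))"
    using C[OF a] a by (simp add: field_simps)
  then show ?thesis using F[OF a] by simp
qed


subsection \<open>Higher derivatives on the positive half-line\<close>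

text \<open>\<open>deriv\<close> at a point depends only on nearby values, and the positive
  half-line is open, so agreement there passes to the next derivative.\<close>

lemma higher_deriv_eqI:
  fixes F :: "nat \<Rightarrow> real \<Rightarrow> real"
  assumes F: "\<And>n x. x > 0 \<Longrightarrow> (F n has_real_derivative F (Suc n) x) (at x)"
  shows "x > 0 \<Longrightarrow> (deriv ^^ n) (F 0) x = F n x"
proof (induction n arbitrary: x)
  case (Suc n)
  have "((deriv ^^ n) (F 0) has_real_derivative F (Suc n) x) (at x)"
    using Suc by (intro has_field_derivative_transform_within_open[OF F, of x "{0<..}"]) auto
  then show ?case by (simp add: DERIV_imp_deriv)
qed simp

text \<open>Derivatives enter as witnesses rather than through \<open>deriv\<close>, so closure
  under sums and products follows by direct induction.\<close>

primrec times_differentiable :: "nat \<Rightarrow> (real \<Rightarrow> real) \<Rightarrow> bool" where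
  "times_differentiable 0 f \<longleftrightarrow> True"
| "times_differentiable (Suc n) f \<longleftrightarrow>
     (\<exists>f'. (\<forall>x>0. (f has_real_derivative f' x) (at x)) \<and> times_differentiable n f')"

lemma times_differentiable_SucD: "times_differentiable (Suc n) f \<Longrightarrow> times_differentiable n f"
  by (induction n arbitrary: f) auto

lemma times_differentiable_const: "times_differentiable n (\<lambda>_. c)"
proof (induction n arbitrary: c)
  case (Suc n)
  then show ?case by (auto intro!: exI[of _ "\<lambda>_. 0"])
qed simp

lemma times_differentiable_add:
  "times_differentiable n f \<Longrightarrow> times_differentiable n g \<Longrightarrow> times_differentiable n (\<lambda>x. f x + g x)"
proof (induction n arbitrary: f g)
  case (Suc n)
  then obtain f' g' where
    "\<forall>x>0. (f has_real_derivative f' x) (at x)" "times_differentiable n f'"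
    "\<forall>x>0. (g has_real_derivative g' x) (at x)" "times_differentiable n g'"
    by auto
  then show ?case
    using Suc.IH by (auto intro!: exI[of _ "\<lambda>x. f' x + g' x"] DERIV_add)
qed simp

lemma times_differentiable_mult:
  "times_differentiable n f \<Longrightarrow> times_differentiable n g \<Longrightarrow> times_differentiable n (\<lambda>x. f x * g x)"
proof (induction n arbitrary: f g)
  case (Suc n)
  then obtain f' g' where
    "\<forall>x>0. (f has_real_derivative f' x) (at x)" "times_differentiable n f'"
    "\<forall>x>0. (g has_real_derivative g' x) (at x)" "times_differentiable n g'"
    by auto
  then show ?case
    using Suc.IH Suc.prems[THEN times_differentiable_SucD]
    by (auto intro!: exI[of _ "\<lambda>x. f' x * g x + g' x * f x"] DERIV_mult times_differentiable_add)
qed simp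

lemma times_differentiable_power:
  "times_differentiable n f \<Longrightarrow> times_differentiable n (\<lambda>x. f x ^ p)"
  by (induction p) (auto intro: times_differentiable_const times_differentiable_mult)

text \<open>The derivative is minus the square of the function itself, so the induction closes by
  the product rule.\<close>

lemma times_differentiable_inverse_shift:
  assumes "c \<ge> 0"
  shows "times_differentiable n (\<lambda>x. inverse (x + c))"
proof (induction n)
  case (Suc n)
  have "((\<lambda>x. inverse (x + c)) has_real_derivative (- 1) * (inverse (x + c) * inverse (x + c))) (at x)"
    if "x > 0" for x
    using that assms by (auto intro!: derivative_eq_intros simp: power2_eq_square)
  then show ?case
    using times_differentiable_mult[OF times_differentiable_const times_differentiable_mult[OF Suc Suc], of "- 1"]
    by (auto intro!: exI[of _ "\<lambda>x. (- 1) * (inverse (x + c) * inverse (x + c))"])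
qed simp

lemma times_differentiable_ln: "times_differentiable n ln"
proof (cases n)
  case (Suc n')
  have "times_differentiable n' inverse"
    using times_differentiable_inverse_shift[of 0 n'] by simp
  then show ?thesis
    using Suc by (auto intro!: exI[of _ inverse] DERIV_ln)
qed simp

lemma times_differentiable_cong:
  assumes "\<And>x. x > 0 \<Longrightarrow> f x = g x" and "times_differentiable n f"
  shows "times_differentiable n g"
proof (cases n)
  case (Suc n')
  then obtain f' where f': "\<And>x. x > 0 \<Longrightarrow> (f has_real_derivative f' x) (at x)" "times_differentiable n' f'"
    using assms(2) by auto
  have "(g has_real_derivative f' x) (at x)" if "x > 0" for x
    using assms(1) that
    by (intro has_field_derivative_transform_within_open[OF f'(1), of x "{0<..}"]) auto
  then show ?thesis using f'(2) Suc by auto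
qed simp

text \<open>Passes from witnesses to iterated \<open>deriv\<close>: on the positive half-line each
  witness equals \<open>deriv f\<close>, which inherits its differentiability.\<close>

lemma times_differentiable_has_higher_deriv:
  "times_differentiable (Suc n) f \<Longrightarrow> x > 0 \<Longrightarrow>
     ((deriv ^^ n) f has_real_derivative (deriv ^^ Suc n) f x) (at x)"
proof (induction n arbitrary: f)
  case 0
  then show ?case by simp (metis DERIV_imp_deriv)
next
  case (Suc n)
  then obtain f' where f': "\<And>x. x > 0 \<Longrightarrow> (f has_real_derivative f' x) (at x)" "times_differentiable (Suc n) f'"
    by (auto simp del: times_differentiable.simps(2) simp: times_differentiable.simps(2)[of "Suc n"])
  have "f' x = deriv f x" if "x > 0" for x
    using DERIV_imp_deriv[OF f'(1)[OF that]] by simp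
  then have "times_differentiable (Suc n) (deriv f)"
    using f'(2) by (rule times_differentiable_cong)
  from Suc.IH[OF this Suc.prems(2)] show ?case
    by (simp add: funpow_swap1)
qed

lemma times_differentiable_ln_power_over:
  "times_differentiable n (\<lambda>b. ln b ^ p / (b + 1) ^ q)"
  using times_differentiable_mult[OF times_differentiable_power[OF times_differentiable_ln]
      times_differentiable_power[OF times_differentiable_inverse_shift[of 1]], of n p q]
  by (simp add: divide_inverse power_inverse)

subsection \<open>The closed form and its derivatives\<close>

text \<open>This is \<open>S k\<close> of the overview. The first and third summands have explicit
  \<open>m\<close>-th derivatives and become the terms of the theorem written without
  derivatives.\<close>

definition log_sum :: "nat \<Rightarrow> real \<Rightarrow> real" where
  "log_sum k b = pi\<^sup>2 / 2 * (1 / (b + 1) ^ (k + 1)) + 1 / 2 * ((ln b)\<^sup>2 / (b + 1) ^ (k + 1))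
     + (\<Sum>j<k. harm (k - j - 1) / real (k - j) * (1 / (b + 1) ^ (j + 1)))
     + (\<Sum>j<k. 1 / real (k - j) * (ln b / (b + 1) ^ (j + 1)))"

text \<open>The index \<open>j = 0\<close> splits off the logarithm and \<open>harm k\<close>; every
  other term is its predecessor for \<open>k\<close> divided by \<open>1 + b\<close>.\<close>

lemma log_sum_Suc:
  assumes b: "b > 0"
  shows "log_sum (Suc k) b = (log_sum k b + (ln b + harm k) / (real k + 1)) / (1 + b)"
proof -
  have s1: "(\<Sum>j<Suc k. harm (Suc k - j - 1) / real (Suc k - j) * (1 / (b + 1) ^ (j + 1)))
     = (harm k / (real k + 1) + (\<Sum>j<k. harm (k - j - 1) / real (k - j) * (1 / (b + 1) ^ (j + 1)))) / (1 + b)"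
    by (subst sum.lessThan_Suc_shift) (simp add: add_divide_distrib sum_divide_distrib add_ac mult_ac)
  have s2: "(\<Sum>j<Suc k. 1 / real (Suc k - j) * (ln b / (b + 1) ^ (j + 1)))
     = (ln b / (real k + 1) + (\<Sum>j<k. 1 / real (k - j) * (ln b / (b + 1) ^ (j + 1)))) / (1 + b)"
    by (subst sum.lessThan_Suc_shift) (simp add: add_divide_distrib sum_divide_distrib add_ac mult_ac)
  show ?thesis
    unfolding log_sum_def s1 s2 by (simp add: add_divide_distrib add_ac mult_ac)
qed

lemma log_sum_has_derivative:
  "b > 0 \<Longrightarrow> (log_sum k has_real_derivative ((ln b + harm k) / b - (real k + 1) * log_sum k b) / (1 + b)) (at b)"
proof (induction k arbitrary: b)
  case 0
  have "((\<lambda>b. (pi\<^sup>2 + (ln b)\<^sup>2) / (2 * (b + 1))) has_real_derivative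
      (ln b / b - (pi\<^sup>2 + (ln b)\<^sup>2) / (2 * (b + 1))) / (1 + b)) (at b)"
    using 0 by (auto intro!: derivative_eq_intros simp: divide_simps) (simp add: algebra_simps)
  moreover have "log_sum 0 = (\<lambda>b. (pi\<^sup>2 + (ln b)\<^sup>2) / (2 * (b + 1)))"
    by (simp add: log_sum_def fun_eq_iff add_divide_distrib)
  ultimately show ?case by (simp add: harm_def)
next
  case (Suc k)
  define S where "S = log_sum k b"
  define h :: real where "h = harm k"
  define c where "c = real k + 1"
  have c: "c > 0" by (simp add: c_def)
  have "((\<lambda>b. (log_sum k b + (ln b + harm k) / (real k + 1)) / (1 + b)) has_real_derivative
     ((((ln b + h) / b - c * S) / (1 + b) + 1 / b / c) * (1 + b) - (S + (ln b + h) / c) * 1) / ((1 + b) * (1 + b))) (at b)"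
    unfolding S_def h_def c_def
    by (rule DERIV_divide DERIV_add Suc.IH DERIV_cdivide)+
       (use Suc.prems in \<open>auto intro!: derivative_eq_intros\<close>)
  then have "(log_sum (Suc k) has_real_derivative
     ((((ln b + h) / b - c * S) / (1 + b) + 1 / b / c) * (1 + b) - (S + (ln b + h) / c) * 1) / ((1 + b) * (1 + b))) (at b)"
    by (rule has_field_derivative_transform_within_open[of _ _ _ "{0<..}"]) (use Suc.prems in \<open>auto simp: log_sum_Suc\<close>)
  then show ?case
  proof (rule DERIV_cong)
    \<comment> \<open>The summand \<open>1 / c\<close>, which comes from differentiating
      \<open>ln b / c\<close>, later turns \<open>harm k\<close> into
      \<open>harm (Suc k)\<close>.\<close>
    have "((((ln b + h) / b - c * S) / (1 + b) + 1 / b / c) * (1 + b) - (S + (ln b + h) / c) * 1) / ((1 + b) * (1 + b))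
       = ((ln b + (h + 1 / c)) / b - (c + 1) * ((S + (ln b + h) / c) / (1 + b))) / (1 + b)"
      using c Suc.prems by (simp add: divide_simps) (simp add: algebra_simps)
    then show "((((ln b + h) / b - c * S) / (1 + b) + 1 / b / c) * (1 + b) - (S + (ln b + h) / c) * 1) / ((1 + b) * (1 + b))
       = ((ln b + harm (Suc k)) / b - (real (Suc k) + 1) * log_sum (Suc k) b) / (1 + b)"
      unfolding log_sum_Suc[OF Suc.prems] by (simp add: S_def h_def c_def harm_Suc field_simps)
  qed
qed

text \<open>The recursion is the \<open>m\<close>-fold derivative of the differential equation for \<open>log_sum k\<close>.\<close>

primrec log_sum_deriv :: "nat \<Rightarrow> nat \<Rightarrow> real \<Rightarrow> real" where
  "log_sum_deriv k 0 = log_sum k"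
| "log_sum_deriv k (Suc m) = (\<lambda>b. ((- 1) ^ m * fact m * (ln b + harm k - harm m) / b ^ (m + 1)
      - real (k + m + 1) * log_sum_deriv k m b) / (1 + b))"

text \<open>Differentiating the recursion multiplied by \<open>1 + b\<close> produces one extra copy
  of the current derivative, which raises the coefficient \<open>k + m + 1\<close> by one.\<close>

lemma log_sum_deriv_has_derivative:
  "b > 0 \<Longrightarrow> (log_sum_deriv k m has_real_derivative log_sum_deriv k (Suc m) b) (at b)"
proof (induction m arbitrary: b)
  case 0
  then show ?case using log_sum_has_derivative[of b k] by (simp add: harm_def add_ac)
next
  case (Suc m)
  note b = Suc.prems
  \<comment> \<open>\<open>Q m\<close> is the \<open>m\<close>-th derivative of
    \<open>(ln b + harm k) / b\<close>; \<open>harm m\<close> collects the contributions from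
    differentiating the logarithm.\<close>
  define Q where "Q = (\<lambda>m b. (- 1) ^ m * fact m * (ln b + harm k - harm m) / b ^ (m + 1) :: real)"
  have Q: "(Q m has_real_derivative Q (Suc m) b) (at b)"
  proof -
    define s :: real where "s = (- 1) ^ m * fact m"
    define h :: real where "h = harm k - harm m"
    have pow: "((\<lambda>b. b ^ (m + 1)) has_real_derivative real (m + 1) * b ^ m) (at b)"
      using DERIV_pow[of "m + 1" b] by simp
    have "(Q m has_real_derivative (s * (1 / b) * b ^ (m + 1) - s * (ln b + h) * (real (m + 1) * b ^ m)) / (b ^ (m + 1) * b ^ (m + 1))) (at b)"
      unfolding Q_def s_def h_def add_diff_eq
      by (rule DERIV_divide[OF DERIV_cmult[THEN DERIV_cong] pow]) (use b in \<open>auto intro!: derivative_eq_intros\<close>)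
    moreover have "(s * (1 / b) * b ^ (m + 1) - s * (ln b + h) * (real (m + 1) * b ^ m)) / (b ^ (m + 1) * b ^ (m + 1))
        = Q (Suc m) b"
    proof -
      have "Q (Suc m) b = - s * real (m + 1) * (ln b + h - 1 / real (m + 1)) / b ^ (m + 2)"
        by (simp add: Q_def s_def h_def harm_Suc field_simps)
      also have "- s * real (m + 1) * (ln b + h - 1 / real (m + 1)) = s - s * (ln b + h) * real (m + 1)"
        by (simp add: right_diff_distrib left_diff_distrib mult_ac del: of_nat_Suc of_nat_add)
      also have "(s - s * (ln b + h) * real (m + 1)) / b ^ (m + 2) = b ^ m * (s - s * (ln b + h) * real (m + 1)) / (b ^ m * b ^ (m + 2))"
        using b by simp
      finally show ?thesis using b by (simp add: algebra_simps)
    qed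
    ultimately show ?thesis by simp
  qed
  define D where "D = log_sum_deriv k (Suc m) b"
  define c where "c = real (k + m + 1)"
  have D: "D = (Q m b - c * log_sum_deriv k m b) / (1 + b)" by (simp add: D_def Q_def c_def)
  have "((\<lambda>b. (Q m b - c * log_sum_deriv k m b) / (1 + b)) has_real_derivative
     ((Q (Suc m) b - c * D) * (1 + b) - (Q m b - c * log_sum_deriv k m b) * 1) / ((1 + b) * (1 + b))) (at b)"
    unfolding D_def
    by (rule DERIV_divide DERIV_diff Q DERIV_cmult Suc.IH b)+
       (use b in \<open>auto intro!: derivative_eq_intros\<close>)
  moreover have eq1: "log_sum_deriv k (Suc m) = (\<lambda>b. (Q m b - c * log_sum_deriv k m b) / (1 + b))"
    by (simp add: Q_def c_def)
  moreover have eq2: "((Q (Suc m) b - c * D) * (1 + b) - (Q m b - c * log_sum_deriv k m b) * 1) / ((1 + b) * (1 + b))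
     = log_sum_deriv k (Suc (Suc m)) b"
  proof -
    have "Q m b - c * log_sum_deriv k m b = D * (1 + b)" using b D by simp
    then have "((Q (Suc m) b - c * D) * (1 + b) - (Q m b - c * log_sum_deriv k m b) * 1) / ((1 + b) * (1 + b))
       = ((Q (Suc m) b - (c + 1) * D) * (1 + b)) / ((1 + b) * (1 + b))"
      by (simp add: algebra_simps)
    also have "\<dots> = (Q (Suc m) b - (c + 1) * D) / (1 + b)" using b by simp
    finally show ?thesis
      by (simp only: log_sum_deriv.simps(2)[of k "Suc m"] D_def Q_def c_def) (simp add: add_ac)
  qed
  ultimately show ?case unfolding eq1 eq2[symmetric] by argo
qed


text \<open>The recursion suits the integrals, the right-hand side suits the theorem. Both are
  chains of successive derivatives starting at \<open>log_sum k\<close>, hence equal.\<close>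

lemma higher_deriv_log_sum:
  assumes "b > 0"
  shows "log_sum_deriv k m b =
     pi\<^sup>2 / 2 * ((- 1) ^ m * (fact (k + m) / fact k) / (b + 1) ^ (k + m + 1))
     + 1 / 2 * (deriv ^^ m) (\<lambda>b. (ln b)\<^sup>2 / (b + 1) ^ (k + 1)) b
     + (\<Sum>j<k. harm (k - j - 1) / real (k - j) * ((- 1) ^ m * (fact (j + m) / fact j) / (b + 1) ^ (j + m + 1)))
     + (\<Sum>j<k. 1 / real (k - j) * (deriv ^^ m) (\<lambda>b. ln b / (b + 1) ^ (j + 1)) b)"
    (is "_ = ?G m b")
proof -
  \<comment> \<open>\<open>W j m\<close> is the \<open>m\<close>-th derivative of
    \<open>1 / (b + 1) ^ (j + 1)\<close>.\<close>
  define W where "W = (\<lambda>j m (b::real). (- 1) ^ m * (fact (j + m) / fact j) / (b + 1) ^ (j + m + 1) :: real)"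
  have W: "(W j m has_real_derivative W j (Suc m) b) (at b)" if "b > 0" for j m b
  proof -
    define s :: real where "s = (- 1) ^ m * (fact (j + m) / fact j)"
    have "((\<lambda>b. (b + 1) ^ (j + m + 1)) has_real_derivative real (j + m + 1) * (b + 1) ^ (j + m)) (at b)"
      using DERIV_shift[of "\<lambda>b. b ^ (j + m + 1)" "real (j + m + 1) * (b + 1) ^ (j + m)" b 1] DERIV_pow[of "j + m + 1" "b + 1"]
      by simp
    then have "(W j m has_real_derivative
      (0 * (b + 1) ^ (j + m + 1) - s * (real (j + m + 1) * (b + 1) ^ (j + m))) / ((b + 1) ^ (j + m + 1) * (b + 1) ^ (j + m + 1))) (at b)"
      unfolding W_def s_def[symmetric] using that by (intro DERIV_divide DERIV_const) auto
    moreover have "(0 * (b + 1) ^ (j + m + 1) - s * (real (j + m + 1) * (b + 1) ^ (j + m))) / ((b + 1) ^ (j + m + 1) * (b + 1) ^ (j + m + 1))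
      = W j (Suc m) b"
      using that by (simp add: W_def s_def)
    ultimately show ?thesis by simp
  qed
  have U: "((deriv ^^ m) (\<lambda>b. (ln b)\<^sup>2 / (b + 1) ^ (k + 1)) has_real_derivative
      (deriv ^^ Suc m) (\<lambda>b. (ln b)\<^sup>2 / (b + 1) ^ (k + 1)) b) (at b)" if "b > 0" for m b
    by (intro times_differentiable_has_higher_deriv times_differentiable_ln_power_over that)
  have V: "((deriv ^^ m) (\<lambda>b. ln b / (b + 1) ^ (j + 1)) has_real_derivative
      (deriv ^^ Suc m) (\<lambda>b. ln b / (b + 1) ^ (j + 1)) b) (at b)" if "b > 0" for m b j
    using times_differentiable_has_higher_deriv[OF times_differentiable_ln_power_over[of "Suc m" 1 "j + 1"] that]
    by (simp only: power_one_right)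
  have "(?G n has_real_derivative ?G (Suc n) x) (at x)" if "x > 0" for n x
    using W[OF that] unfolding W_def
    by (intro DERIV_add DERIV_cmult DERIV_sum U V that)
  from higher_deriv_eqI[where F = ?G, OF this assms]
  have "(deriv ^^ m) (?G 0) b = ?G m b" .
  moreover have "?G 0 = log_sum k" by (simp add: log_sum_def fun_eq_iff)
  ultimately have "(deriv ^^ m) (log_sum k) b = ?G m b" by (simp only:)
  moreover have "(deriv ^^ m) (log_sum k) b = log_sum_deriv k m b"
    using higher_deriv_eqI[where F = "log_sum_deriv k", OF log_sum_deriv_has_derivative assms] by simp
  ultimately show ?thesis by (simp only:)
qed

section \<open>The integrals for all \<open>m\<close> and \<open>k\<close> in terms of the closed
  form\<close>

text \<open>Induction on \<open>m\<close> by the second pole reduction; its base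
  \<open>m = 0\<close> is an induction on \<open>k\<close> by the first. At \<open>b = 1 / a\<close>
  these reductions become the recurrences of \<open>log_sum_deriv\<close> and
  \<open>log_sum\<close>.\<close>

lemma ln_pole_integral:
  fixes a :: real
  assumes a: "a > 0"
  shows "((\<lambda>x. x ^ m * ln x / ((x - 1) * (x + a) ^ (k + m + 1))) has_integral
    ((- 1) ^ m * (fact k / fact (k + m)) * log_sum_deriv k m (1 / a) / a ^ (k + m + 1))) {0<..}"
proof (induction m)
  case 0
  have "((\<lambda>x. x ^ 0 * ln x / ((x - 1) * (x + a) ^ (k + 0 + 1))) has_integral
    (log_sum k (1 / a) / a ^ (k + 1))) {0<..}"
  proof (induction k)
    case 0
    have "log_sum 0 (1 / a) / a ^ (0 + 1) = (pi\<^sup>2 + (ln a)\<^sup>2) / (2 * (1 + a))"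
      using a by (simp add: log_sum_def ln_div divide_simps) (simp add: algebra_simps)
    then show ?case using ln_pole_integral_base[OF a] by simp
  next
    case (Suc k)
    define S where "S = log_sum k (1 / a)"
    define h :: real where "h = harm k"
    define c where "c = real k + 1"
    have c: "c > 0" by (simp add: c_def)
    have "(S / a ^ (k + 1) - fact 0 * fact k / fact (k + 0 + 1) * (ln a + harm 0 - harm k) / a ^ (k + 1)) / (1 + a)
      = (S / a ^ (k + 1) - (ln a - h) / c / a ^ (k + 1)) / (1 + a)"
      by (simp add: h_def c_def add_ac harm_def)
    also have "\<dots> = (S + (- ln a + h) / c) / (1 + 1 / a) / a ^ (Suc k + 1)"
      using a c by (simp add: divide_simps) (simp add: algebra_simps)
    also have "\<dots> = log_sum (Suc k) (1 / a) / a ^ (Suc k + 1)"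
      using a by (simp add: log_sum_Suc ln_div S_def h_def c_def)
    finally show ?case
      using pole_reduction_integral(1)[OF a Suc.IH] unfolding S_def by (simp only:)
  qed
  then show ?case by simp
next
  case (Suc m)
  define D where "D = log_sum_deriv k m (1 / a)"
  define s :: real where "s = (- 1) ^ m"
  have ss: "s * s = 1" unfolding s_def by (simp flip: power_mult_distrib)
  define L where "L = ln a + harm m - harm k"
  define c where "c = real (k + m + 1)"
  have c: "c > 0" by (simp add: c_def)
  define q :: real where "q = fact k / fact (k + m)"
  have q: "fact k / fact (k + Suc m) = q / c" "fact m * fact k / fact (k + m + 1) = q * fact m / c"
    by (simp_all add: q_def c_def add_ac mult_ac)
  have "ln (1 / a) + harm k - harm m = - L" using a by (simp add: L_def ln_div)
  then have step: "log_sum_deriv k (Suc m) (1 / a) = (s * fact m * (- L) * a ^ (m + 1) - c * D) / (1 + 1 / a)"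
    by (simp only: log_sum_deriv.simps s_def D_def c_def) (simp add: power_divide)
  have "(- 1) ^ Suc m * (fact k / fact (k + Suc m)) * log_sum_deriv k (Suc m) (1 / a) / a ^ (k + Suc m + 1)
    = - s * (q / c) * ((s * fact m * (- L) * a ^ (m + 1) - c * D) / (1 + 1 / a)) / a ^ (k + Suc m + 1)"
    unfolding step q(1) by (simp add: s_def)
  \<comment> \<open>The sign inside the recurrence meets the one in the prefactor, and their product
    is 1.\<close>
  also have "\<dots> = ((s * s) * q * fact m / c * L * a ^ (m + 1) + s * q * D) / (1 + a) / a ^ (k + m + 1)"
    using a c by (simp add: divide_simps) (simp add: algebra_simps)
  also have "\<dots> = (s * q * D / a ^ (k + m + 1) + a * (q * fact m / c * L / a ^ (k + 1))) / (1 + a)"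
    using a c unfolding ss by (simp add: divide_simps power_add)
  finally have eq: "(- 1) ^ Suc m * (fact k / fact (k + Suc m)) * log_sum_deriv k (Suc m) (1 / a) / a ^ (k + Suc m + 1)
    = (s * q * D / a ^ (k + m + 1) + a * (q * fact m / c * L / a ^ (k + 1))) / (1 + a)" .
  show ?case
    unfolding eq
    using pole_reduction_integral(2)[OF a Suc.IH] unfolding D_def s_def q(2) L_def unfolding q_def .
qed

section \<open>Rewriting the closed form into the stated terms\<close>

theorem theorem10:
  fixes m k :: nat and a :: real
  assumes "a > 0"
  shows "((\<lambda>x::real. x ^ m * ln x / ((x - 1) * (x + a) ^ (k + m + 1))) has_integral
      (pi\<^sup>2 / (2 * (a + 1) ^ (k + m + 1))
       + (-1) ^ m / (2 * fact m * real ((k + m) choose m) * a ^ (k + m + 1))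
           * (deriv ^^ m) (\<lambda>b::real. (ln b)\<^sup>2 / (b + 1) ^ (k + 1)) (1 / a)
       + (\<Sum>j<k. real ((j + m) choose m) / real ((k + m) choose m)
             * (harm (k - j - 1) / real (k - j))
             * (a powi (int j - int k) / (a + 1) ^ (j + m + 1)))
       + (-1) ^ m / (fact m * real ((k + m) choose m) * a ^ (k + m + 1))
           * (\<Sum>j<k. 1 / real (k - j)
                * (deriv ^^ m) (\<lambda>b::real. ln b / (b + 1) ^ (j + 1)) (1 / a))))
      {0<..}"
proof -
  define s :: real where "s = (- 1) ^ m"
  have ss: "s * s = 1" unfolding s_def by (simp flip: power_mult_distrib)
  define b where "b = 1 / a"
  have b: "b > 0" using assms by (simp add: b_def)
  define q :: real where "q = fact k / fact (k + m)"
  define U where "U = (deriv ^^ m) (\<lambda>b::real. (ln b)\<^sup>2 / (b + 1) ^ (k + 1)) b"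
  define V where "V = (\<lambda>j. (deriv ^^ m) (\<lambda>b::real. ln b / (b + 1) ^ (j + 1)) b)"
  have choose: "real ((j + m) choose m) = fact (j + m) / fact j / fact m" for j
    using binomial_fact[of m "j + m", where ?'a = real] by (simp add: field_simps)
  have q1: "1 / (fact m * real ((k + m) choose m)) = q"
    by (simp add: choose q_def)
  have qj: "real ((j + m) choose m) / real ((k + m) choose m) = q * (fact (j + m) / fact j)" for j
    by (simp add: choose q_def mult.commute)
  \<comment> \<open>Besides the first sum, this also serves the \<open>pi\<^sup>2\<close> term: for
    \<open>j = k\<close> the power of \<open>a\<close> is 1.\<close>
  have ba: "1 / (b + 1) ^ (j + m + 1) / a ^ (k + m + 1) = a powi (int j - int k) / (a + 1) ^ (j + m + 1)" for j
  proof -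
    have "b + 1 = (a + 1) / a" using assms by (simp add: b_def field_simps)
    then have "1 / (b + 1) ^ (j + m + 1) / a ^ (k + m + 1) = a ^ (j + m + 1) / a ^ (k + m + 1) / (a + 1) ^ (j + m + 1)"
      by (simp add: power_divide)
    also have "a ^ (j + m + 1) / a ^ (k + m + 1) = a ^ j / a ^ k"
      using assms by (simp add: power_add)
    also have "\<dots> = a powi (int j - int k)"
      using assms by (simp add: power_int_diff)
    finally show ?thesis .
  qed
  \<comment> \<open>The derivatives of powers of \<open>1 / (b + 1)\<close> carry the sign
    \<open>s\<close>, which cancels against the prefactor; this is why two of the four terms end up
    without a sign.\<close>
  have "s * q * log_sum_deriv k m b / a ^ (k + m + 1)
     = pi\<^sup>2 / 2 * (s * s) * (q * (fact (k + m) / fact k)) * (1 / (b + 1) ^ (k + m + 1) / a ^ (k + m + 1))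
       + s * (q / 2) / a ^ (k + m + 1) * U
       + (\<Sum>j<k. (s * s) * (q * (fact (j + m) / fact j)) * (harm (k - j - 1) / real (k - j)) * (1 / (b + 1) ^ (j + m + 1) / a ^ (k + m + 1)))
       + s * q / a ^ (k + m + 1) * (\<Sum>j<k. 1 / real (k - j) * V j)"
    unfolding higher_deriv_log_sum[OF b] s_def[symmetric] U_def[symmetric] V_def
    by (simp add: distrib_left add_divide_distrib sum_distrib_left sum_divide_distrib mult_ac)
  also have "\<dots> = pi\<^sup>2 / (2 * (a + 1) ^ (k + m + 1))
       + s / (2 * fact m * real ((k + m) choose m) * a ^ (k + m + 1)) * U
       + (\<Sum>j<k. real ((j + m) choose m) / real ((k + m) choose m)
             * (harm (k - j - 1) / real (k - j))
             * (a powi (int j - int k) / (a + 1) ^ (j + m + 1)))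
       + s / (fact m * real ((k + m) choose m) * a ^ (k + m + 1)) * (\<Sum>j<k. 1 / real (k - j) * V j)"
    unfolding ss ba qj by (simp add: q1[symmetric] choose mult_ac)
  finally show ?thesis
    using ln_pole_integral[OF assms, of m k]
    unfolding s_def q_def U_def V_def b_def by (simp only:)
qed

end
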